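(* A restriction semifunctor $\mathsf p:\mathbb E\to\mathbb B$ between restriction categories is hyperconnected if and only if it is separated and admissible.
   Context: Composition is written in diagrammatic order. A restriction category is a category with an operation sending each $f:A\to B$ to $\overline f:A\to A$ such that (R.1) $\overline f f=f$; (R.2) $\overline f\,\overline g=\overline g\,\overline f$ for $f,g$ with the same domain; (R.3) $\overline{\overline f g}=\overline f\,\overline g$ for $f,g$ with the same domain; (R.4) $f\overline g=\overline{fg}\,f$ for composable $f,g$. A restriction idempotent is an endomap $e=\overline e$; the restriction idempotents on $X$ form a meet semilattice $\mathcal O(X)$ with meet given by composition. A restriction semifunctor preserves domains, codomains, composition and restriction ($F(\overline f)=\overline{F(f)}$), but not necessarily identities. A commuting triangle $kf=g$ (with left factor $k$) is precise if $\overline g=\overline k$. An arrow $f':X'\to X$ of $\mathbb E$ is $\mathsf p$-prone if whenever $g:Y\to X$ in $\mathbb E$ and $h:\mathsf p(Y)\to\mathsf p(X')$ in $\mathbb B$ are such that $h\,\mathsf p(f')=\mathsf p(g)$ is precise, there is a unique $\widetilde h:Y\to X'$ with $\mathsf p(\widetilde h)=h$ and $\widetilde h f'=g$ precise. $\mathsf p$ is hyperconnected if for every $X\in\mathbb E$ the map $\mathcal O(X)\to\{d\in\mathcal O(\mathsf p(X)): d\,\mathsf p(1_X)=d\}$, $e\mapsto\mathsf p(e)$, is an isomorphism. $\mathsf p$ is separated if for any $X\in\mathbb E$ and restriction idempotents $e,e'$ on $X$, $\mathsf p(e)=\mathsf p(e')$ implies $e=e'$. $\mathsf p$ is admissible if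 for every $X\in\mathbb E$ and every restriction idempotent $e$ on $\mathsf p(X)$ with $e\,\mathsf p(1_X)=e$ there is a $\mathsf p$-prone restriction idempotent $e^*$ on $X$ with $\mathsf p(e^* )=e$. *)

theory Defs
  imports "HOL-Algebra.Group"
begin

record ('o, 'm) rcat =
  Obj :: "'o set"
  Arr :: "'m set"
  Dom :: "'m \<Rightarrow> 'o"
  Cod :: "'m \<Rightarrow> 'o"
  Ident :: "'o \<Rightarrow> 'm"
  Comp :: "'m \<Rightarrow> 'm \<Rightarrow> 'm"  (infixl \<open>\<Zsemi>\<index>\<close> 70)
  Restr :: "'m \<Rightarrow> 'm"

definition Hom :: "('o, 'm, 'z) rcat_scheme \<Rightarrow> 'o \<Rightarrow> 'o \<Rightarrow> 'm set"
  where "Hom C A B = {f \<in> Arr C. Dom C f = A \<and> Cod C f = B}"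

text \<open>Composition is in diagrammatic order: for \<open>f : X \<rightarrow> Y\<close> and \<open>g : Y \<rightarrow> Z\<close>,
  the composite \<open>f \<Zsemi> g : X \<rightarrow> Z\<close> is first \<open>f\<close>, then \<open>g\<close>. Nothing is assumed about
  values of the operations outside \<open>Obj\<close> and \<open>Arr\<close> or on non-composable pairs.\<close>

locale category =
  fixes C :: "('o, 'm, 'z) rcat_scheme" (structure)
  assumes Dom_closed: "f \<in> Arr C \<Longrightarrow> Dom C f \<in> Obj C"
    and Cod_closed: "f \<in> Arr C \<Longrightarrow> Cod C f \<in> Obj C"
    and Ident_in_Hom: "X \<in> Obj C \<Longrightarrow> Ident C X \<in> Hom C X X"
    and Comp_in_Hom: "\<lbrakk>f \<in> Hom C X Y; g \<in> Hom C Y Z\<rbrakk> \<Longrightarrow> f \<Zsemi> g \<in> Hom C X Z"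
    and Ident_left: "f \<in> Hom C X Y \<Longrightarrow> Ident C X \<Zsemi> f = f"
    and Ident_right: "f \<in> Hom C X Y \<Longrightarrow> f \<Zsemi> Ident C Y = f"
    and Comp_assoc: "\<lbrakk>f \<in> Hom C W X; g \<in> Hom C X Y; h \<in> Hom C Y Z\<rbrakk>
      \<Longrightarrow> (f \<Zsemi> g) \<Zsemi> h = f \<Zsemi> (g \<Zsemi> h)"

locale restriction_category = category +
  assumes Restr_in_Hom: "f \<in> Hom C X Y \<Longrightarrow> Restr C f \<in> Hom C X X"
    and R1: "f \<in> Hom C X Y \<Longrightarrow> Restr C f \<Zsemi> f = f"
    and R2: "\<lbrakk>f \<in> Hom C X Y; g \<in> Hom C X Z\<rbrakk>
      \<Longrightarrow> Restr C f \<Zsemi> Restr C g = Restr C g \<Zsemi> Restr C f"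
    and R3: "\<lbrakk>f \<in> Hom C X Y; g \<in> Hom C X Z\<rbrakk>
      \<Longrightarrow> Restr C (Restr C f \<Zsemi> g) = Restr C f \<Zsemi> Restr C g"
    and R4: "\<lbrakk>f \<in> Hom C X Y; g \<in> Hom C Y Z\<rbrakk>
      \<Longrightarrow> f \<Zsemi> Restr C g = Restr C (f \<Zsemi> g) \<Zsemi> f"

definition restr_idems :: "('o, 'm, 'z) rcat_scheme \<Rightarrow> 'o \<Rightarrow> 'm set"
  where "restr_idems C X = {e \<in> Hom C X X. e = Restr C e}"

record ('o1, 'm1, 'o2, 'm2) fmap =
  omap :: "'o1 \<Rightarrow> 'o2"
  amap :: "'m1 \<Rightarrow> 'm2"

text \<open>Identities need not be preserved.\<close>

locale restriction_semifunctor =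
  E: restriction_category E + B: restriction_category B
  for E :: "('o1, 'm1, 'y) rcat_scheme"
    and B :: "('o2, 'm2, 'z) rcat_scheme" +
  fixes p :: "('o1, 'm1, 'o2, 'm2, 'x) fmap_scheme"
  assumes omap_closed: "X \<in> Obj E \<Longrightarrow> omap p X \<in> Obj B"
    and amap_in_Hom: "f \<in> Hom E X Y \<Longrightarrow> amap p f \<in> Hom B (omap p X) (omap p Y)"
    and amap_Comp: "\<lbrakk>f \<in> Hom E X Y; g \<in> Hom E Y Z\<rbrakk>
      \<Longrightarrow> amap p (f \<Zsemi>\<^bsub>E\<^esub> g) = amap p f \<Zsemi>\<^bsub>B\<^esub> amap p g"
    and amap_Restr: "f \<in> Hom E X Y \<Longrightarrow> amap p (Restr E f) = Restr B (amap p f)"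

definition precise :: "('o, 'm, 'z) rcat_scheme \<Rightarrow> 'm \<Rightarrow> 'm \<Rightarrow> 'm \<Rightarrow> bool"
  where "precise C k f g \<longleftrightarrow> k \<Zsemi>\<^bsub>C\<^esub> f = g \<and> Restr C g = Restr C k"

definition prone ::
  "('o1, 'm1, 'y) rcat_scheme \<Rightarrow> ('o2, 'm2, 'z) rcat_scheme
    \<Rightarrow> ('o1, 'm1, 'o2, 'm2, 'x) fmap_scheme \<Rightarrow> 'm1 \<Rightarrow> bool"
  where "prone E B p f' \<longleftrightarrow>
    f' \<in> Arr E \<and>
    (\<forall>Y \<in> Obj E. \<forall>g \<in> Hom E Y (Cod E f'). \<forall>h \<in> Hom B (omap p Y) (omap p (Dom E f')).
      precise B h (amap p f') (amap p g) \<longrightarrow>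
      (\<exists>!k. k \<in> Hom E Y (Dom E f') \<and> amap p k = h \<and> precise E k f' g))"

text \<open>The meet semilattice \<open>\<O>(X)\<close>, presented as the idempotent commutative monoid
  whose multiplication (composition) is the meet and whose unit is the top element.\<close>

definition restr_idem_semilattice :: "('o, 'm, 'z) rcat_scheme \<Rightarrow> 'o \<Rightarrow> 'm monoid"
  where "restr_idem_semilattice C X =
    \<lparr>carrier = restr_idems C X, mult = Comp C, one = Ident C X\<rparr>"

text \<open>The subsemilattice of those \<open>d \<in> \<O>(p X)\<close> with \<open>d \<Zsemi> p(1\<^sub>X) = d\<close>; its top
  element is \<open>p(1\<^sub>X)\<close>.\<close>

definition restr_idem_semilattice_below ::
  "('o1, 'm1, 'y) rcat_scheme \<Rightarrow> ('o2, 'm2, 'z) rcat_scheme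
    \<Rightarrow> ('o1, 'm1, 'o2, 'm2, 'x) fmap_scheme \<Rightarrow> 'o1 \<Rightarrow> 'm2 monoid"
  where "restr_idem_semilattice_below E B p X =
    \<lparr>carrier = {d \<in> restr_idems B (omap p X). d \<Zsemi>\<^bsub>B\<^esub> amap p (Ident E X) = d},
     mult = Comp B, one = amap p (Ident E X)\<rparr>"

definition hyperconnected ::
  "('o1, 'm1, 'y) rcat_scheme \<Rightarrow> ('o2, 'm2, 'z) rcat_scheme
    \<Rightarrow> ('o1, 'm1, 'o2, 'm2, 'x) fmap_scheme \<Rightarrow> bool"
  where "hyperconnected E B p \<longleftrightarrow>
    (\<forall>X \<in> Obj E.
      amap p \<in> iso (restr_idem_semilattice E X) (restr_idem_semilattice_below E B p X))"

definition separated ::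
  "('o1, 'm1, 'y) rcat_scheme \<Rightarrow> ('o1, 'm1, 'o2, 'm2, 'x) fmap_scheme \<Rightarrow> bool"
  where "separated E p \<longleftrightarrow>
    (\<forall>X \<in> Obj E. \<forall>e \<in> restr_idems E X. \<forall>e' \<in> restr_idems E X.
      amap p e = amap p e' \<longrightarrow> e = e')"

definition admissible ::
  "('o1, 'm1, 'y) rcat_scheme \<Rightarrow> ('o2, 'm2, 'z) rcat_scheme
    \<Rightarrow> ('o1, 'm1, 'o2, 'm2, 'x) fmap_scheme \<Rightarrow> bool"
  where "admissible E B p \<longleftrightarrow>
    (\<forall>X \<in> Obj E. \<forall>e \<in> restr_idems B (omap p X).
      e \<Zsemi>\<^bsub>B\<^esub> amap p (Ident E X) = e \<longrightarrow>
      (\<exists>e' \<in> restr_idems E X. prone E B p e' \<and> amap p e' = e))"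

text \<open>The two monoids above are indeed commutative and idempotent, i.e. meet
  semilattices with top.\<close>

context restriction_category
begin

lemma Restr_Ident: "X \<in> Obj C \<Longrightarrow> Restr C (Ident C X) = Ident C X"
  by (metis Ident_in_Hom Ident_right R1 Restr_in_Hom)

lemma restr_idems_Hom: "e \<in> restr_idems C X \<Longrightarrow> e \<in> Hom C X X"
  and restr_idems_Restr: "e \<in> restr_idems C X \<Longrightarrow> Restr C e = e"
  by (simp_all add: restr_idems_def)

lemma restr_idems_Ident: "X \<in> Obj C \<Longrightarrow> Ident C X \<in> restr_idems C X"
  by (simp add: restr_idems_def Ident_in_Hom Restr_Ident)

lemma restr_idems_idem: "e \<in> restr_idems C X \<Longrightarrow> e \<Zsemi> e = e"
  by (metis R1 restr_idems_Hom restr_idems_Restr)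

lemma restr_idems_commute:
  "\<lbrakk>d \<in> restr_idems C X; e \<in> restr_idems C X\<rbrakk> \<Longrightarrow> d \<Zsemi> e = e \<Zsemi> d"
  by (metis R2 restr_idems_Hom restr_idems_Restr)

lemma restr_idems_Comp:
  "\<lbrakk>d \<in> restr_idems C X; e \<in> restr_idems C X\<rbrakk> \<Longrightarrow> d \<Zsemi> e \<in> restr_idems C X"
  using R3[of d X X e X] Comp_in_Hom[of d X X e X] by (simp add: restr_idems_def)

lemma comm_monoid_restr_idems:
  assumes "X \<in> Obj C"
  shows "comm_monoid (restr_idem_semilattice C X)"
  by (rule comm_monoidI)
    (use assms in \<open>auto simp: restr_idem_semilattice_def restr_idems_Comp restr_idems_Ident
      intro: restr_idems_commute Ident_left Comp_assoc dest: restr_idems_Hom\<close>)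

end

context restriction_semifunctor
begin

lemma amap_restr_idems: "e \<in> restr_idems E X \<Longrightarrow> amap p e \<in> restr_idems B (omap p X)"
  using amap_in_Hom[of e X X] amap_Restr[of e X X] by (simp add: restr_idems_def)

lemma comm_monoid_restr_idems_below:
  assumes "X \<in> Obj E"
  shows "comm_monoid (restr_idem_semilattice_below E B p X)"
proof -
  let ?i = "amap p (Ident E X)"
  have i: "?i \<in> restr_idems B (omap p X)"
    by (simp add: amap_restr_idems E.restr_idems_Ident assms)
  have assoc: "a \<Zsemi>\<^bsub>B\<^esub> b \<Zsemi>\<^bsub>B\<^esub> c = a \<Zsemi>\<^bsub>B\<^esub> (b \<Zsemi>\<^bsub>B\<^esub> c)"
    if "a \<in> restr_idems B (omap p X)" "b \<in> restr_idems B (omap p X)"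
      "c \<in> restr_idems B (omap p X)" for a b c
    using that by (meson B.Comp_assoc B.restr_idems_Hom)
  show ?thesis
    by (rule comm_monoidI)
      (use i in \<open>auto simp: restr_idem_semilattice_below_def assoc B.restr_idems_Comp
        B.restr_idems_idem intro: B.restr_idems_commute dest: B.restr_idems_commute[OF i]\<close>)
qed

end

end

(* Postcomposing with a restriction idempotent e is trivial in a precise triangle: by (R.4),
   k e = g with equal restrictions forces k = g. Hence, as soon as p is separated, every
   restriction idempotent is p-prone (the lift of h is g itself), and admissibility reduces to
   surjectivity of p on restriction idempotents, while separatedness is injectivity. *)
theory Submission
  imports Defs
begin

context restriction_category
begin

lemma precise_restr_idem:
  assumes e: "e \<in> restr_idems C Y" and k: "k \<in> Hom C X Y" and pr: "precise C k e g"
  shows "k = g"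
proof -
  have "g = k \<Zsemi> Restr C e"
    using e pr by (simp add: precise_def restr_idems_Restr)
  \<comment> \<open>(R.4) applies because \<open>e\<close> is its own restriction; preciseness then
    turns the restriction of k e into that of k, which (R.1) absorbs.\<close>
  also have "\<dots> = Restr C (k \<Zsemi> e) \<Zsemi> k"
    using R4 k restr_idems_Hom[OF e] by blast
  also have "\<dots> = k"
    using pr R1[OF k] by (simp add: precise_def)
  finally show ?thesis by simp
qed

text \<open>(R.3) with an identity as second arrow. This makes restrictions of arbitrary arrows
  available to separatedness.\<close>

lemma Restr_restr_idems:
  assumes f: "f \<in> Hom C X Y"
  shows "Restr C f \<in> restr_idems C X"
proof -
  have X: "X \<in> Obj C"
    using f Dom_closed by (auto simp: Hom_def)
  have "Restr C (Restr C f) = Restr C f"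
    using R3[OF f Ident_in_Hom[OF X]] Ident_right[OF Restr_in_Hom[OF f]]
    by (simp add: Restr_Ident X)
  then show ?thesis
    using Restr_in_Hom[OF f] by (simp add: restr_idems_def)
qed

end

context restriction_semifunctor
begin

lemma separated_imp_prone:
  assumes sep: "separated E p" and X: "X \<in> Obj E" and e: "e \<in> restr_idems E X"
  shows "prone E B p e"
proof -
  have eH: "e \<in> Hom E X X" and pe: "amap p e \<in> restr_idems B (omap p X)"
    using e by (simp_all add: E.restr_idems_Hom amap_restr_idems)
  then have eX: "e \<in> Arr E" "Dom E e = X" "Cod E e = X"
    by (auto simp: Hom_def)
  have "\<exists>!k. k \<in> Hom E Y X \<and> amap p k = h \<and> precise E k e g"
    if Y: "Y \<in> Obj E" and g: "g \<in> Hom E Y X" and h: "h \<in> Hom B (omap p Y) (omap p X)"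
      and pr: "precise B h (amap p e) (amap p g)" for Y g h
  proof (rule ex1I)
    \<comment> \<open>The triangle in B ends in the restriction idempotent p(e), so it is trivial
      too; this singles out \<open>g\<close> as the candidate lift.\<close>
    have hg: "h = amap p g"
      using B.precise_restr_idem[OF pe h pr] .
    have ge: "g \<Zsemi>\<^bsub>E\<^esub> e \<in> Hom E Y X"
      using E.Comp_in_Hom[OF g eH] .
    have "amap p (g \<Zsemi>\<^bsub>E\<^esub> e) = amap p g"
      using pr hg by (simp add: amap_Comp[OF g eH] precise_def)
    \<comment> \<open>Separatedness compares restriction idempotents only, so the equation p(g e) =
      p(g) is passed to restrictions, which are such idempotents on \<open>Y\<close>.\<close>
    then have "amap p (Restr E (g \<Zsemi>\<^bsub>E\<^esub> e)) = amap p (Restr E g)"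
      by (simp add: amap_Restr[OF g] amap_Restr[OF ge])
    then have "Restr E (g \<Zsemi>\<^bsub>E\<^esub> e) = Restr E g"
      using sep Y E.Restr_restr_idems[OF g] E.Restr_restr_idems[OF ge]
      by (simp add: separated_def)
    \<comment> \<open>By (R.4), g e is the restriction of g e followed by g, and that restriction is
      now the one of g.\<close>
    then have "g \<Zsemi>\<^bsub>E\<^esub> e = g"
      using E.R4[OF g eH] E.R1[OF g] E.restr_idems_Restr[OF e] by simp
    then show "g \<in> Hom E Y X \<and> amap p g = h \<and> precise E g e g"
      using g hg by (simp add: precise_def)
  next
    fix k assume "k \<in> Hom E Y X \<and> amap p k = h \<and> precise E k e g"
    then show "k = g"
      using E.precise_restr_idem[OF e] by blast
  qed
  then show ?thesis
    by (simp add: prone_def eX)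
qed

text \<open>Images lie below p(1) because p preserves the composite e 1 = e, even when p(1) is not
  an identity.\<close>

lemma amap_hom_restr_idems:
  assumes "X \<in> Obj E"
  shows "amap p \<in> hom (restr_idem_semilattice E X) (restr_idem_semilattice_below E B p X)"
proof -
  have "amap p e \<Zsemi>\<^bsub>B\<^esub> amap p (Ident E X) = amap p e" if "e \<in> restr_idems E X" for e
    by (metis E.Ident_in_Hom E.Ident_right E.restr_idems_Hom amap_Comp assms that)
  then show ?thesis
    by (auto simp: hom_def restr_idem_semilattice_def restr_idem_semilattice_below_def
      amap_restr_idems intro: amap_Comp E.restr_idems_Hom)
qed

text \<open>The homomorphism half of \<open>iso\<close> is automatic, which leaves injectivity and
  surjectivity to be matched with the two conditions.\<close>

lemma hyperconnected_alt:
  "hyperconnected E B p \<longleftrightarrow>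
    (\<forall>X \<in> Obj E. bij_betw (amap p) (restr_idems E X)
      {d \<in> restr_idems B (omap p X). d \<Zsemi>\<^bsub>B\<^esub> amap p (Ident E X) = d})"
  using amap_hom_restr_idems
  by (simp add: hyperconnected_def iso_def restr_idem_semilattice_def
    restr_idem_semilattice_below_def)

lemma hyperconnected_iff_separated_admissible:
  "hyperconnected E B p \<longleftrightarrow> separated E p \<and> admissible E B p"
proof
  assume hyp: "hyperconnected E B p"
  then have sep: "separated E p"
    by (auto simp: hyperconnected_alt separated_def bij_betw_def dest: inj_onD)
  have "\<exists>e' \<in> restr_idems E X. prone E B p e' \<and> amap p e' = e"
    if X: "X \<in> Obj E" and e: "e \<in> restr_idems B (omap p X)"
      "e \<Zsemi>\<^bsub>B\<^esub> amap p (Ident E X) = e" for X e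
  proof -
    \<comment> \<open>Surjectivity gives a preimage, and separatedness makes it prone.\<close>
    have "e \<in> amap p ` restr_idems E X"
      using hyp X e by (simp add: hyperconnected_alt bij_betw_def)
    then show ?thesis
      using separated_imp_prone[OF sep X] by blast
  qed
  with sep show "separated E p \<and> admissible E B p"
    by (simp add: admissible_def)
next
  assume sa: "separated E p \<and> admissible E B p"
  show "hyperconnected E B p"
    unfolding hyperconnected_alt
  proof
    fix X assume X: "X \<in> Obj E"
    let ?D = "{d \<in> restr_idems B (omap p X). d \<Zsemi>\<^bsub>B\<^esub> amap p (Ident E X) = d}"
    have "inj_on (amap p) (restr_idems E X)"
      using sa X by (auto simp: separated_def intro: inj_onI)
    moreover have "amap p ` restr_idems E X \<subseteq> ?D"
      using hom_carrier[OF amap_hom_restr_idems[OF X]]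
      by (simp add: restr_idem_semilattice_def restr_idem_semilattice_below_def)
    \<comment> \<open>The prone lift from admissibility serves as the preimage.\<close>
    moreover have "?D \<subseteq> amap p ` restr_idems E X"
      using sa X unfolding admissible_def by blast
    ultimately show "bij_betw (amap p) (restr_idems E X) ?D"
      by (simp add: bij_betw_def subset_antisym)
  qed
qed

end

theorem proposition4p18:
  fixes E :: "('o1, 'm1) rcat"
    and B :: "('o2, 'm2) rcat"
    and p :: "('o1, 'm1, 'o2, 'm2) fmap"
  assumes "restriction_category E"
    and "restriction_category B"
    and "restriction_semifunctor E B p"
  shows "hyperconnected E B p \<longleftrightarrow> separated E p \<and> admissible E B p"
  by (rule restriction_semifunctor.hyperconnected_iff_separated_admissible[OF assms(3)])

end
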